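(* Let $m$ be a non-negative integer. Let $q,a,x$ be complex numbers (with a fixed choice of square root $q^{1/2}$) for which $q,a\neq 0$ and no denominator occurring below vanishes (equivalently, the identity is one of rational functions in indeterminates). Then $$ {}_{3}\phi_{2}\left[\begin{array}{c} q^{-2m}, a, x\\ x^2,\, 0\end{array};q,q\right] =a^m\, {}_{4}\phi_{3}\left[\begin{array}{c} q^{-m}, xq^{m}, a, x^2/a\\ xq^{\frac{1}{2}}, -xq^{\frac{1}{2}}, -x\end{array};q,q\right]. $$
   Context: The $q$-shifted factorial is $(a;q)_0=1$ and $(a;q)_k=(1-a)(1-aq)\cdots(1-aq^{k-1})$ for $k\geq 1$. The basic hypergeometric series is $$ {}_{r}\phi_{s}\left[\begin{array}{c} a_1,\ldots,a_{r}\\ b_1,\ldots,b_{s}\end{array};q, z\right] =\sum_{k=0}^{\infty}\frac{(a_1;q)_k\cdots (a_r;q)_k}{(q;q)_k (b_1;q)_k \cdots (b_s;q)_k}\left((-1)^k q^{k(k-1)/2}\right)^{1+s-r} z^k . $$ When one of the upper parameters is $q^{-N}$ with $N$ a non-negative integer, the series terminates: $(q^{-N};q)_k=0$ for $k>N$, so the sum is the finite sum over $0\le k\le N$. Note that $(0;q)_k=1$. *)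

theory Defs
  imports "HOL-Analysis.Analysis"
begin

definition qshift :: "complex \<Rightarrow> complex \<Rightarrow> nat \<Rightarrow> complex" where
  "qshift a q k = (\<Prod>i<k. 1 - a * q ^ i)"

definition hyp_term ::
    "complex list \<Rightarrow> complex list \<Rightarrow> complex \<Rightarrow> complex \<Rightarrow> nat \<Rightarrow> complex" where
  "hyp_term as bs q z k =
     (\<Prod>a\<leftarrow>as. qshift a q k) / (qshift q q k * (\<Prod>b\<leftarrow>bs. qshift b q k))
     * ((-1) ^ k * q ^ (k * (k - 1) div 2)) powi (1 + int (length bs) - int (length as))
     * z ^ k"

text \<open>
  The upper parameters \<open>as\<close> and the lower parameters \<open>bs\<close> are lists, so that their lengths are
  \<open>r\<close> and \<open>s\<close>. If \<open>q \<noteq> 0\<close> and some upper parameter is \<open>q powi (- int N)\<close>, all terms with index \<open>k > N\<close> have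
  a vanishing numerator, hence are \<open>0\<close> (by \<open>0 / 0 = 0\<close> even if the denominator vanishes there),
  and the series is the finite sum over \<open>k \<le> N\<close>; see \<open>basic_hyp_terminates\<close>.
\<close>
definition basic_hyp ::
    "complex list \<Rightarrow> complex list \<Rightarrow> complex \<Rightarrow> complex \<Rightarrow> complex" where
  "basic_hyp as bs q z = (\<Sum>k. hyp_term as bs q z k)"

lemma qshift_power_neg_eq_0:
  assumes "q \<noteq> 0" "N < k"
  shows "qshift (q powi (- int N)) q k = 0"
proof -
  have "1 - q powi (- int N) * q ^ N = 0"
    using assms(1) by (simp add: power_int_minus)
  with assms(2) show ?thesis
    unfolding qshift_def by (intro prod_zero) auto
qed

lemma basic_hyp_terminates:
  assumes "q \<noteq> 0" "q powi (- int N) \<in> set as"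
  shows "basic_hyp as bs q z = (\<Sum>k\<le>N. hyp_term as bs q z k)"
  unfolding basic_hyp_def
proof (rule suminf_finite)
  fix k assume "k \<notin> {..N}"
  then have "qshift (q powi (- int N)) q k = 0"
    using assms(1) by (intro qshift_power_neg_eq_0) auto
  then have "0 \<in> set (map (\<lambda>a. qshift a q k) as)"
    using assms(2) by force
  then have "(\<Prod>a\<leftarrow>as. qshift a q k) = 0"
    by (simp only: prod_list_zero_iff)
  then show "hyp_term as bs q z k = 0"
    by (simp add: hyp_term_def)
qed simp

text \<open>
  Only the indices up to the termination index \<open>N\<close> are constrained; the later terms do not occur
  in the sum, so \<open>qshift q q k\<close> may vanish there (for instance if \<open>q\<close> is a root of unity).
\<close>
definition denoms_nonzero :: "complex list \<Rightarrow> complex \<Rightarrow> nat \<Rightarrow> bool" where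
  "denoms_nonzero bs q N \<longleftrightarrow>
     (\<forall>k\<le>N. qshift q q k \<noteq> 0 \<and> (\<forall>b\<in>set bs. qshift b q k \<noteq> 0))"

end

theory Submission
  imports Defs
begin

text \<open>
  Fix \<open>q\<close>, \<open>x\<close> and \<open>n = 2 * m\<close>, and read both sides as functions of \<open>a\<close>. Each is a polynomial of
  degree at most \<open>n\<close>. On the right, the factor \<open>a ^ m\<close> clears the denominators of \<open>x ^ 2 / a\<close>.
  The point is that both solve one second-order \<open>q\<close>-difference equation,
  \<open>- x (1 - a) f(aq) + q^n (a - x^2) f(a/q) + (1 + x q^n) (x - a) f(a) = 0\<close>,
  which for \<open>x \<noteq> 0\<close> is up to normalisation the equation of the continuous \<open>q\<close>-ultraspherical (Rogers)
  polynomial \<open>C\<^sub>n\<close> with parameter \<open>x\<close>, in the variable \<open>a / x = exp (- 2 * \<i> * \<theta>)\<close>. It arises as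
  follows: the coefficients \<open>c\<^sub>k = (x;q)\<^sub>k (x;q)\<^sub>n\<^sub>-\<^sub>k / ((q;q)\<^sub>k (q;q)\<^sub>n\<^sub>-\<^sub>k)\<close> of that polynomial satisfy a
  two-term recurrence, and the shift \<open>a \<mapsto> aq\<close> turns it into an equation for the sum of
  \<open>c\<^sub>k (a / x)^k\<close>.

  For each side the equation is checked termwise. Applied to a partial sum, the operator leaves a
  single boundary term (\<open>rogers_op_qshift_sum\<close>, \<open>rogers_op_symmetric_sum\<close>), and this boundary term
  vanishes at the index where the series terminates.

  Conversely, a solution is determined by its value at \<open>a = 1\<close>. There the coefficient of \<open>f(aq)\<close>
  is \<open>0\<close>, so the equation yields \<open>f(1/q)\<close>, and then successively \<open>f(1/q^2), ..., f(1/q^n)\<close>, as long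
  as the coefficient \<open>a - x^2\<close> of \<open>f(a/q)\<close> is nonzero. This is the condition that the denominators
  \<open>(x^2;q)\<^sub>k\<close> do not vanish. The \<open>n + 1\<close> points are distinct because \<open>(q;q)\<^sub>n \<noteq> 0\<close>, so a polynomial
  of degree at most \<open>n\<close> is fixed by these values (\<open>rogers_op_kernel_poly\<close>). Both sides equal \<open>1\<close> at
  \<open>a = 1\<close>, hence they agree. Arguing with values instead of coefficients also covers the degenerate
  parameters \<open>x = 0\<close> and \<open>x = q^-i\<close>.
\<close>

section \<open>Shifted factorials and the difference operator\<close>

lemma qshift_0 [simp]: "qshift a q 0 = 1"
  by (simp add: qshift_def)

lemma qshift_Suc: "qshift a q (Suc k) = qshift a q k * (1 - a * q ^ k)"
  by (simp add: qshift_def)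

lemma qshift_Suc_shift: "qshift a q (Suc k) = (1 - a) * qshift (a * q) q k"
  unfolding qshift_def by (subst prod.lessThan_Suc_shift) (simp add: mult.assoc)

lemma qshift_zero_base [simp]: "qshift 0 q k = 1"
  by (simp add: qshift_def)

text \<open>
  For \<open>N = q ^ n\<close> this \<open>q\<close>-difference operator annihilates the Rogers polynomial of degree \<open>n\<close>,
  normalised to be a polynomial in \<open>a\<close>.
\<close>
definition rogers_op ::
    "complex \<Rightarrow> complex \<Rightarrow> complex \<Rightarrow> (complex \<Rightarrow> complex) \<Rightarrow> complex \<Rightarrow> complex" where
  "rogers_op q x N f a =
     - x * (1 - a) * f (a * q) + N * (a - x ^ 2) * f (a / q) + (1 + x * N) * (x - a) * f a"

lemma rogers_op_add:
  "rogers_op q x N (\<lambda>a. f a + g a) a = rogers_op q x N f a + rogers_op q x N g a"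
  by (simp add: rogers_op_def algebra_simps)

lemma rogers_op_diff:
  "rogers_op q x N (\<lambda>a. f a - g a) a = rogers_op q x N f a - rogers_op q x N g a"
  by (simp add: rogers_op_def algebra_simps)

section \<open>The two series solve the difference equation\<close>

text \<open>
  With \<open>N = q^n\<close>, the operator maps the basis element \<open>(a;q)\<^sub>k\<close> to
  \<open>a q^(k-1) A\<^sub>k (a;q)\<^sub>k\<^sub>-\<^sub>1 - a q^k C\<^sub>k (a;q)\<^sub>k\<close>, where \<open>A\<^sub>k = N (1 - x^2 q^(k-1)) (1 - q^-k) / q^(k-1)\<close>
  and \<open>C\<^sub>k = q^-k (1 - x q^k) (1 - N q^-k)\<close>. The coefficient ratio says exactly that
  \<open>A\<^sub>k\<^sub>+\<^sub>1 p\<^sub>k\<^sub>+\<^sub>1 = C\<^sub>k p\<^sub>k\<close>, so the sum telescopes. At \<open>K = n\<close> the right-hand side is \<open>0\<close>.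
\<close>
lemma rogers_op_qshift_sum:
  assumes q: "q \<noteq> 0"
    and nz: "\<And>k. k < n \<Longrightarrow> (1 - q ^ Suc k) * (1 - x ^ 2 * q ^ k) \<noteq> 0"
    and ratio: "\<And>k. k < n \<Longrightarrow> p (Suc k) * ((1 - q ^ Suc k) * (1 - x ^ 2 * q ^ k))
                   = p k * ((1 - q ^ k / q ^ n) * (1 - x * q ^ k) * q)"
    and "K \<le> n"
  shows "rogers_op q x (q ^ n) (\<lambda>a. \<Sum>k\<le>K. p k * qshift a q k) a
         = - a * (1 - x * q ^ K) * (1 - q ^ n / q ^ K) * p K * qshift a q K"
  using \<open>K \<le> n\<close>
proof (induction K)
  case 0
  then show ?case by (simp add: rogers_op_def algebra_simps power2_eq_square)
next
  case (Suc K)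
  \<comment> \<open>Writing both \<open>p K\<close> and \<open>p (Suc K)\<close> as multiples of \<open>s\<close> makes the step a polynomial identity.\<close>
  define s where "s = p K / ((1 - q ^ Suc K) * (1 - x ^ 2 * q ^ K))"
  define Q N where "Q = q ^ K" and "N = q ^ n"
  have QN: "Q \<noteq> 0" "N \<noteq> 0" using q by (auto simp: Q_def N_def)
  have K: "K < n" using Suc.prems by simp
  have pK: "p K = s * ((1 - q * Q) * (1 - x ^ 2 * Q))"
    using nz[OF K] by (simp add: s_def Q_def)
  have pS: "p (Suc K) = s * ((1 - Q / N) * (1 - x * Q) * q)"
    using ratio[OF K] nz[OF K] by (simp add: s_def Q_def N_def field_simps)
  define S where "S = qshift a q K"
  have e1: "(1 - a) * qshift (a * q) q (Suc K) = S * (1 - a * Q) * (1 - a * (q * Q))"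
    using qshift_Suc_shift[of a q "Suc K"] by (simp add: qshift_Suc S_def Q_def)
  have e2: "qshift (a / q) q (Suc K) = (1 - a / q) * S"
    using qshift_Suc_shift[of "a / q" q K] q by (simp add: S_def)
  have e3: "qshift a q (Suc K) = S * (1 - a * Q)"
    by (simp add: qshift_Suc S_def Q_def)
  have "rogers_op q x N (\<lambda>a. p (Suc K) * qshift a q (Suc K)) a
      = p (Suc K) * (- x * ((1 - a) * qshift (a * q) q (Suc K))
          + N * (a - x ^ 2) * qshift (a / q) q (Suc K)
          + (1 + x * N) * (x - a) * qshift a q (Suc K))"
    by (simp add: rogers_op_def algebra_simps)
  also have "\<dots> = p (Suc K) * S * (- x * (1 - a * Q) * (1 - a * (q * Q))
          + N * (a - x ^ 2) * (1 - a / q) + (1 + x * N) * (x - a) * (1 - a * Q))"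
    unfolding e1 e2 e3 by (simp add: algebra_simps)
  also have "\<dots> = a * (1 - x * Q) * (1 - N / Q) * p K * S
      - a * (1 - x * (q * Q)) * (1 - N / (q * Q)) * p (Suc K) * (S * (1 - a * Q))"
    unfolding pK pS using QN q by (simp add: divide_simps) algebra
  finally have "rogers_op q x N (\<lambda>a. p (Suc K) * qshift a q (Suc K)) a = \<dots>" .
  with Suc.IH K e3 show ?case
    by (simp add: rogers_op_add S_def Q_def N_def)
qed

text \<open>
  Let \<open>\<phi>\<^sub>k = (a;q)\<^sub>k (x^2/a;q)\<^sub>k\<close>, which is invariant under \<open>a \<mapsto> x^2/a\<close>. The factor \<open>a^m\<close> scales
  \<open>f(aq)\<close> and \<open>f(a/q)\<close> by \<open>q^m\<close> and \<open>q^-m\<close>, which makes the operator compatible with this symmetry.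
  As a result it maps \<open>a^m \<phi>\<^sub>k\<close> to \<open>a^m (x - a) (\<alpha>\<^sub>k \<phi>\<^sub>k + \<beta>\<^sub>k \<phi>\<^sub>k\<^sub>-\<^sub>1)\<close> with
  \<open>\<alpha>\<^sub>k = (1 - q^(m-k)) (1 - x q^(m+k))\<close> and
  \<open>\<beta>\<^sub>k = - q^m (1 - q^-k) (1 - x^2 q^(2k-1)) (1 + x q^(k-1))\<close>. The coefficient ratio says that
  \<open>\<beta>\<^sub>k\<^sub>+\<^sub>1 r\<^sub>k\<^sub>+\<^sub>1 = - \<alpha>\<^sub>k r\<^sub>k\<close>, so the sum telescopes. At \<open>K = m\<close> the right-hand side is \<open>0\<close>.
\<close>
lemma rogers_op_symmetric_sum:
  assumes q: "q \<noteq> 0" and a: "a \<noteq> 0"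
    and nz: "\<And>k. k < m \<Longrightarrow>
               (1 - q ^ Suc k) * (1 - x ^ 2 * q * (q ^ k) ^ 2) * (1 + x * q ^ k) \<noteq> 0"
    and ratio: "\<And>k. k < m \<Longrightarrow>
       r (Suc k) * ((1 - q ^ Suc k) * (1 - x ^ 2 * q * (q ^ k) ^ 2) * (1 + x * q ^ k))
       = r k * ((1 - q ^ k / q ^ m) * (1 - x * q ^ m * q ^ k) * q)"
    and "K \<le> m"
  shows "rogers_op q x (q ^ (2 * m))
           (\<lambda>a. \<Sum>k\<le>K. a ^ m * r k * qshift a q k * qshift (x ^ 2 / a) q k) a
         = a ^ m * (x - a) * (1 - q ^ m / q ^ K) * (1 - x * q ^ m * q ^ K) * r K
           * qshift a q K * qshift (x ^ 2 / a) q K"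
  using \<open>K \<le> m\<close>
proof (induction K)
  case 0
  have "rogers_op q x (q ^ (2 * m)) (\<lambda>a. a ^ m * r 0) a
      = a ^ m * r 0 * (- x * (1 - a) * q ^ m + q ^ m * (a - x ^ 2)
          + (1 + x * (q ^ m) ^ 2) * (x - a))"
    using q by (simp add: rogers_op_def power_mult_distrib power_divide field_simps
        mult_2_right power_add power2_eq_square)
  also have "\<dots> = a ^ m * (x - a) * (1 - q ^ m) * (1 - x * q ^ m) * r 0"
    by algebra
  finally show ?case by simp
next
  case (Suc K)
  define s where
    "s = r K / ((1 - q ^ Suc K) * (1 - x ^ 2 * q * (q ^ K) ^ 2) * (1 + x * q ^ K))"
  define Q M where "Q = q ^ K" and "M = q ^ m"
  have QM: "Q \<noteq> 0" "M \<noteq> 0" using q by (auto simp: Q_def M_def)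
  have K: "K < m" using Suc.prems by simp
  have rK: "r K = s * ((1 - q * Q) * (1 - x ^ 2 * q * Q ^ 2) * (1 + x * Q))"
    using nz[OF K] by (simp add: s_def Q_def)
  have rS: "r (Suc K) = s * ((1 - Q / M) * (1 - x * M * Q) * q)"
    using ratio[OF K] nz[OF K] by (simp add: s_def Q_def M_def nonzero_eq_divide_eq mult_ac)
  define S T where "S = qshift a q K" and "T = qshift (x ^ 2 / a) q K"
  have e1: "(1 - a) * qshift (a * q) q (Suc K) = S * (1 - a * Q) * (1 - a * (q * Q))"
    using qshift_Suc_shift[of a q "Suc K"] by (simp add: qshift_Suc S_def Q_def)
  have e2: "qshift (a / q) q (Suc K) = (1 - a / q) * S"
    using qshift_Suc_shift[of "a / q" q K] q by (simp add: S_def)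
  have e3: "qshift a q (Suc K) = S * (1 - a * Q)"
    by (simp add: qshift_Suc S_def Q_def)
  have "(1 - x ^ 2 / a) * qshift (x ^ 2 / a * q) q (Suc K)
      = T * (1 - x ^ 2 / a * Q) * (1 - x ^ 2 / a * (q * Q))"
    using qshift_Suc_shift[of "x ^ 2 / a" q "Suc K"] by (simp add: qshift_Suc T_def Q_def)
  moreover have "a - x ^ 2 = a * (1 - x ^ 2 / a)" "x ^ 2 / (a / q) = x ^ 2 / a * q"
    using a q by (simp_all add: field_simps)
  ultimately have f1: "(a - x ^ 2) * qshift (x ^ 2 / (a / q)) q (Suc K)
      = a * (T * (1 - x ^ 2 / a * Q) * (1 - x ^ 2 / a * (q * Q)))"
    by (simp only: mult.assoc)
  have f2: "qshift (x ^ 2 / (a * q)) q (Suc K) = (1 - x ^ 2 / (a * q)) * T"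
    using qshift_Suc_shift[of "x ^ 2 / (a * q)" q K] q by (simp add: T_def)
  have f3: "qshift (x ^ 2 / a) q (Suc K) = T * (1 - x ^ 2 / a * Q)"
    by (simp add: qshift_Suc T_def Q_def)
  have pw: "M ^ 2 * (a / q) ^ m = M * a ^ m" "(a * q) ^ m = M * a ^ m"
      "q ^ (2 * m) = M ^ 2"
    using q by (simp_all add: M_def power_divide power_mult_distrib mult_2 power_add
        power2_eq_square)
  have "rogers_op q x (q ^ (2 * m))
          (\<lambda>a. a ^ m * r (Suc K) * qshift a q (Suc K) * qshift (x ^ 2 / a) q (Suc K)) a
      = r (Suc K) * (- x * (a * q) ^ m * ((1 - a) * qshift (a * q) q (Suc K))
            * qshift (x ^ 2 / (a * q)) q (Suc K)
          + (q ^ (2 * m) * (a / q) ^ m) * qshift (a / q) q (Suc K)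
            * ((a - x ^ 2) * qshift (x ^ 2 / (a / q)) q (Suc K))
          + (1 + x * q ^ (2 * m)) * (x - a) * a ^ m * qshift a q (Suc K)
            * qshift (x ^ 2 / a) q (Suc K))"
    unfolding rogers_op_def by (simp only: algebra_simps)
  also have "\<dots> = a ^ m * r (Suc K) * S * T *
      (- x * M * (1 - a * Q) * (1 - a * (q * Q)) * (1 - x ^ 2 / (a * q))
       + M * (1 - a / q) * a * (1 - x ^ 2 / a * Q) * (1 - x ^ 2 / a * (q * Q))
       + (1 + x * M ^ 2) * (x - a) * (1 - a * Q) * (1 - x ^ 2 / a * Q))"
    unfolding e1 e2 e3 f1 f2 f3 pw by algebra
  also have "\<dots> = a ^ m * S * T * (x - a) *
      (r (Suc K) * ((1 - M / (q * Q)) * (1 - x * M * (q * Q))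
            * ((1 - a * Q) * (1 - x ^ 2 / a * Q)))
       - (1 - M / Q) * (1 - x * M * Q) * r K)"
    unfolding rK rS using QM q a by (simp add: divide_simps) algebra
  also have "\<dots> = a ^ m * (x - a) * (1 - M / (q * Q)) * (1 - x * M * (q * Q)) * r (Suc K)
       * (S * (1 - a * Q)) * (T * (1 - x ^ 2 / a * Q))
       - a ^ m * (x - a) * (1 - M / Q) * (1 - x * M * Q) * r K * S * T"
    by algebra
  finally show ?case
    using Suc.IH K unfolding sum.atMost_Suc rogers_op_add e3 f3
    by (simp add: S_def T_def Q_def M_def)
qed

section \<open>Uniqueness of polynomial solutions\<close>

text \<open>
  At \<open>a = q^-i\<close> the equation expresses \<open>f(q^-(i+1))\<close> through the two preceding values, with
  leading coefficient \<open>q^n (q^-i - x^2) \<noteq> 0\<close>. For \<open>i = 0\<close> the factor \<open>1 - a\<close> removes the value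
  at \<open>q\<close>, so a single initial value suffices.
\<close>
lemma rogers_op_kernel_values:
  assumes q: "q \<noteq> 0"
    and x: "\<And>j. j < n \<Longrightarrow> x ^ 2 * q ^ j \<noteq> 1"
    and ker: "\<And>a. a \<noteq> 0 \<Longrightarrow> rogers_op q x (q ^ n) f a = 0"
    and f1: "f 1 = 0" and "j \<le> n"
  shows "f (1 / q ^ j) = 0"
  using \<open>j \<le> n\<close>
proof (induction j rule: less_induct)
  case (less j)
  show ?case
  proof (cases j)
    case 0
    then show ?thesis using f1 by simp
  next
    case (Suc i)
    define b where "b = 1 / q ^ i"
    have b: "b \<noteq> 0" using q by (simp add: b_def)
    have "f b = 0" using less Suc by (simp add: b_def)
    moreover have "(1 - b) * f (b * q) = 0"
    proof (cases i)
      case (Suc l)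
      then have "b * q = 1 / q ^ l" using q by (simp add: b_def)
      then show ?thesis using less.IH[of l] less.prems \<open>j = Suc i\<close> Suc by simp
    qed (simp add: b_def)
    ultimately have "q ^ n * (b - x ^ 2) * f (b / q) = 0"
      using ker[OF b] by (simp add: rogers_op_def)
    moreover have "b - x ^ 2 \<noteq> 0"
      using x[of i] less.prems Suc q by (auto simp: b_def field_simps)
    ultimately have "f (b / q) = 0" using q by simp
    then show ?thesis using Suc by (simp add: b_def mult.commute)
  qed
qed

lemma rogers_op_kernel_poly:
  assumes q: "q \<noteq> 0" and qn: "\<And>j. 0 < j \<Longrightarrow> j \<le> n \<Longrightarrow> q ^ j \<noteq> 1"
    and x: "\<And>j. j < n \<Longrightarrow> x ^ 2 * q ^ j \<noteq> 1"
    and ker: "\<And>a. a \<noteq> 0 \<Longrightarrow> rogers_op q x (q ^ n) (poly P) a = 0"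
    and P1: "poly P 1 = 0" and deg: "degree P \<le> n"
  shows "P = 0"
proof -
  have neq: "q ^ i \<noteq> q ^ j" if "i < j" "j \<le> n" for i j
  proof
    assume "q ^ i = q ^ j"
    moreover have "q ^ j = q ^ i * q ^ (j - i)" using that by (simp flip: power_add)
    ultimately show False using qn[of "j - i"] that q by auto
  qed
  have inj: "inj_on (\<lambda>j. 1 / q ^ j) {..n}"
  proof (rule inj_onI)
    fix i j assume "i \<in> {..n}" "j \<in> {..n}" "1 / q ^ i = 1 / q ^ j"
    then show "i = j" using neq[of i j] neq[of j i] by (cases i j rule: linorder_cases) auto
  qed
  show ?thesis
  proof (rule poly_eqI_degree[where A = "(\<lambda>j. 1 / q ^ j) ` {..n}"])
    show "poly P a = poly 0 a" if "a \<in> (\<lambda>j. 1 / q ^ j) ` {..n}" for a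
      using that rogers_op_kernel_values[OF q x ker P1] by auto
  qed (use deg inj in \<open>simp_all add: card_image\<close>)
qed

lemma degree_prod_linear_le:
  fixes b c :: "nat \<Rightarrow> 'a :: comm_semiring_1"
  shows "degree (\<Prod>i<k. [:b i, c i:]) \<le> k"
proof (induction k)
  case (Suc k)
  then show ?case
    using degree_mult_le[of "\<Prod>i<k. [:b i, c i:]" "[:b k, c k:]"] degree_pCons_le[of "b k" "[:c k:]"]
    by (simp add: prod.lessThan_Suc del: mult_pCons_right)
qed simp

section \<open>Both sides as polynomials in the upper parameter\<close>

lemma qshift_poly:
  "\<exists>P. degree P \<le> k \<and> (\<forall>a. poly P a = qshift a q k)"
proof (intro exI conjI allI)
  show "degree (\<Prod>i<k. [:1, - (q ^ i):]) \<le> k"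
    by (rule degree_prod_linear_le)
  show "poly (\<Prod>i<k. [:1, - (q ^ i):]) a = qshift a q k" for a
    by (simp add: poly_prod qshift_def algebra_simps)
qed

lemma qshift_reversed_poly:
  "\<exists>P. degree P \<le> k \<and> (\<forall>a. a \<noteq> 0 \<longrightarrow> poly P a = a ^ k * qshift (c / a) q k)"
proof (intro exI conjI allI impI)
  show "degree (\<Prod>i<k. [:- (c * q ^ i), 1:]) \<le> k"
    by (rule degree_prod_linear_le)
  fix a :: complex
  assume "a \<noteq> 0"
  have "a ^ k * qshift (c / a) q k = (\<Prod>i<k. a * (1 - c / a * q ^ i))"
    by (simp add: qshift_def prod.distrib)
  also have "\<dots> = (\<Prod>i<k. a - c * q ^ i)"
    using \<open>a \<noteq> 0\<close> by (intro prod.cong) (simp_all add: right_diff_distrib)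
  finally show "poly (\<Prod>i<k. [:- (c * q ^ i), 1:]) a = a ^ k * qshift (c / a) q k"
    by (simp add: poly_prod)
qed

section \<open>The transformation formula\<close>

lemma denoms_nonzero_factor:
  assumes "denoms_nonzero bs q N" "k < N"
  shows "1 - q ^ Suc k \<noteq> 0" "b \<in> set bs \<Longrightarrow> 1 - b * q ^ k \<noteq> 0"
  using assms by (auto simp: denoms_nonzero_def qshift_Suc dest!: spec[of _ "Suc k"])

theorem corollary1p3:
  fixes m :: nat and q sqrt_q a x :: complex
  assumes "sqrt_q ^ 2 = q"
    and "q \<noteq> 0" and "a \<noteq> 0"
    and "denoms_nonzero [x ^ 2, 0] q (2 * m)"
    and "denoms_nonzero [x * sqrt_q, - x * sqrt_q, - x] q m"
  shows "basic_hyp [q powi (- int (2 * m)), a, x] [x ^ 2, 0] q q =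
         a ^ m * basic_hyp [q powi (- int m), x * q ^ m, a, x ^ 2 / a]
                           [x * sqrt_q, - x * sqrt_q, - x] q q"
proof -
  note q = \<open>q \<noteq> 0\<close>
  define p where "p k = qshift (1 / q ^ (2 * m)) q k * qshift x q k
      / (qshift q q k * qshift (x ^ 2) q k) * q ^ k" for k
  define r where "r k = qshift (1 / q ^ m) q k * qshift (x * q ^ m) q k
      / (qshift q q k * (qshift (x * sqrt_q) q k * qshift (- x * sqrt_q) q k * qshift (- x) q k))
      * q ^ k" for k
  define F where "F a = (\<Sum>k\<le>2 * m. p k * qshift a q k)" for a
  define G where "G a = (\<Sum>k\<le>m. a ^ m * r k * qshift a q k * qshift (x ^ 2 / a) q k)" for a
  have powi: "q powi (- int N) = 1 / q ^ N" for N
    by (simp add: power_int_minus field_simps)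
  have lhs: "basic_hyp [q powi (- int (2 * m)), a, x] [x ^ 2, 0] q q = F a"
    by (subst basic_hyp_terminates[OF q, of "2 * m"], simp)
       (unfold powi, simp add: F_def p_def hyp_term_def mult_ac)
  have rhs: "a ^ m * basic_hyp [q powi (- int m), x * q ^ m, a, x ^ 2 / a]
                           [x * sqrt_q, - x * sqrt_q, - x] q q = G a"
    by (subst basic_hyp_terminates[OF q, of m], simp)
       (unfold powi, simp add: G_def r_def hyp_term_def sum_distrib_left mult_ac)
  note d1 = denoms_nonzero_factor[OF assms(4)] and d2 = denoms_nonzero_factor[OF assms(5)]
  have nz1: "1 - q ^ Suc k \<noteq> 0" "1 - x ^ 2 * q ^ k \<noteq> 0" if "k < 2 * m" for k
    using d1[OF that] by simp_all
  have nz2: "1 - q ^ Suc k \<noteq> 0" "1 - x * sqrt_q * q ^ k \<noteq> 0" "1 - (- x * sqrt_q) * q ^ k \<noteq> 0"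
      "1 - (- x) * q ^ k \<noteq> 0" if "k < m" for k
    using d2(1)[OF that] d2(2)[OF that, of "x * sqrt_q"] d2(2)[OF that, of "- x * sqrt_q"]
      d2(2)[OF that, of "- x"] by simp_all
  \<comment> \<open>Only the product of the two parameters with square roots enters, and it is rational in \<open>q\<close>.\<close>
  have fac: "1 - x ^ 2 * q * (q ^ k) ^ 2 = (1 - x * sqrt_q * q ^ k) * (1 - (- x * sqrt_q) * q ^ k)" for k
    unfolding assms(1)[symmetric] by algebra
  have kerF: "rogers_op q x (q ^ (2 * m)) F b = 0" for b
  proof -
    have "p (Suc k) * ((1 - q ^ Suc k) * (1 - x ^ 2 * q ^ k))
        = p k * ((1 - q ^ k / q ^ (2 * m)) * (1 - x * q ^ k) * q)" if "k < 2 * m" for k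
      using nz1[OF that] by (simp add: p_def qshift_Suc mult_ac)
    then have "rogers_op q x (q ^ (2 * m)) F b
        = - b * (1 - x * q ^ (2 * m)) * (1 - q ^ (2 * m) / q ^ (2 * m)) * p (2 * m)
          * qshift b q (2 * m)"
      unfolding F_def using q nz1 by (intro rogers_op_qshift_sum) auto
    then show ?thesis using q by simp
  qed
  have kerG: "rogers_op q x (q ^ (2 * m)) G b = 0" if "b \<noteq> 0" for b
  proof -
    have "r (Suc k) * ((1 - q ^ Suc k) * (1 - x ^ 2 * q * (q ^ k) ^ 2) * (1 + x * q ^ k))
        = r k * ((1 - q ^ k / q ^ m) * (1 - x * q ^ m * q ^ k) * q)" if "k < m" for k
      unfolding fac using nz2[OF that] by (simp add: r_def qshift_Suc mult_ac)
    then have "rogers_op q x (q ^ (2 * m)) G b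
        = b ^ m * (x - b) * (1 - q ^ m / q ^ m) * (1 - x * q ^ m * q ^ m) * r m
           * qshift b q m * qshift (x ^ 2 / b) q m"
      unfolding G_def using q nz2 that fac by (intro rogers_op_symmetric_sum) auto
    then show ?thesis using q by simp
  qed
  \<comment> \<open>At \<open>a = 1\<close> only the terms with index \<open>0\<close> survive.\<close>
  have one: "qshift 1 q k = (if k = 0 then 1 else 0)" for k
    by (cases k) (simp_all add: qshift_Suc_shift)
  have "F 1 = (\<Sum>k\<le>2 * m. if k = 0 then 1 else 0)"
    unfolding F_def by (intro sum.cong) (auto simp: one p_def)
  then have F1: "F 1 = 1" by simp
  have "G 1 = (\<Sum>k\<le>m. if k = 0 then 1 else 0)"
    unfolding G_def by (intro sum.cong) (auto simp: one r_def)
  then have G1: "G 1 = 1" by simp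
  obtain V where V: "\<And>k. degree (V k) \<le> k" "\<And>k a. poly (V k) a = qshift a q k"
    using choice[of "\<lambda>k P. degree P \<le> k \<and> (\<forall>a. poly P a = qshift a q k)"] qshift_poly
    by blast
  obtain W where W: "\<And>k. degree (W k) \<le> k"
      "\<And>k a. a \<noteq> 0 \<Longrightarrow> poly (W k) a = a ^ k * qshift (x ^ 2 / a) q k"
    using choice[of "\<lambda>k P. degree P \<le> k
        \<and> (\<forall>a. a \<noteq> 0 \<longrightarrow> poly P a = a ^ k * qshift (x ^ 2 / a) q k)"] qshift_reversed_poly
    by blast
  \<comment> \<open>Of the factor \<open>a ^ m\<close>, a part \<open>a ^ k\<close> clears the denominators of the \<open>k\<close>-th term and
    \<open>a ^ (m - k)\<close> is left, so that this term has degree at most \<open>(m - k) + k + k \<le> 2 * m\<close>.\<close>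
  define P where "P = (\<Sum>k\<le>2 * m. smult (p k) (V k))
      - (\<Sum>k\<le>m. smult (r k) (monom 1 (m - k) * V k * W k))"
  have P: "poly P b = F b - G b" if "b \<noteq> 0" for b
  proof -
    have "poly (smult (r k) (monom 1 (m - k) * V k * W k)) b
        = b ^ m * r k * qshift b q k * qshift (x ^ 2 / b) q k" if "k \<le> m" for k
    proof -
      have "b ^ m = b ^ (m - k) * b ^ k" using that by (simp flip: power_add)
      then show ?thesis using \<open>b \<noteq> 0\<close> by (simp add: V W poly_monom)
    qed
    then have "poly (\<Sum>k\<le>m. smult (r k) (monom 1 (m - k) * V k * W k)) b = G b"
      unfolding G_def poly_sum by (intro sum.cong refl) (simp only: atMost_iff)
    then show ?thesis
      by (simp add: P_def F_def poly_sum V)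
  qed
  have "P = 0"
  proof (rule rogers_op_kernel_poly[OF q])
    show "q ^ j \<noteq> 1" if "0 < j" "j \<le> 2 * m" for j
      using nz1(1)[of "j - 1"] that by simp
    show "x ^ 2 * q ^ j \<noteq> 1" if "j < 2 * m" for j
      using nz1(2)[OF that] by auto
    show "rogers_op q x (q ^ (2 * m)) (poly P) b = 0" if "b \<noteq> 0" for b
    proof -
      have "rogers_op q x (q ^ (2 * m)) (poly P) b
          = rogers_op q x (q ^ (2 * m)) (\<lambda>b. F b - G b) b"
        using that q by (simp add: rogers_op_def P)
      then show ?thesis using kerF kerG that by (simp add: rogers_op_diff)
    qed
    show "poly P 1 = 0" by (simp add: P F1 G1)
    show "degree P \<le> 2 * m"
      unfolding P_def
    proof (intro degree_diff_le degree_sum_le)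
      show "degree (smult (p k) (V k)) \<le> 2 * m" if "k \<in> {..2 * m}" for k
        using that V(1)[of k] degree_smult_le[of "p k" "V k"] by auto
      show "degree (smult (r k) (monom 1 (m - k) * V k * W k)) \<le> 2 * m" if "k \<in> {..m}" for k
        using that V(1)[of k] W(1)[of k] degree_smult_le[of "r k" "monom 1 (m - k) * V k * W k"]
          degree_mult_le[of "monom 1 (m - k) * V k" "W k"]
          degree_mult_le[of "monom 1 (m - k)" "V k"] degree_monom_le[of "1::complex" "m - k"]
        by simp
    qed simp_all
  qed
  with P[OF \<open>a \<noteq> 0\<close>] lhs rhs show ?thesis by simp
qed

end
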